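(* $\mathbb Q$ is a natural order, and there is an embedding of $\mathbb Z$ into $\mathbb Q$ for $+$, $\cdot$ and $\le$.
   Context: $\mathbb Q$ is the system of rationals: expressions $\frac ac$ with $a,c$ integers and $c\neq 0$, where $\frac ac=\frac bd$ iff $a\cdot d=b\cdot c$; $\frac ac\cdot\frac bd:=\frac{a\cdot b}{c\cdot d}$ and $\frac ac+\frac bd:=\frac{a\cdot d+b\cdot c}{c\cdot d}$. The order is: $\frac ac\le\frac bd$ iff $\frac{a\cdot d}{c\cdot d}\le\frac{b\cdot c}{c\cdot d}$, meaning $a\cdot d\le b\cdot c$ when $c\cdot d>0$, and $b\cdot c\le a\cdot d$ when $c\cdot d<0$. A natural order is a transitive binary relation in which every object appears in exactly one arrow with every other object (i.e. for distinct $x,y$ exactly one of $x\le y$, $y\le x$ holds). An embedding for $+,\cdot,\le$ is an injective map $\iota$ with $\iota(x+y)=\iota(x)+\iota(y)$, $\iota(x\cdot y)=\iota(x)\cdot\iota(y)$, and $x\le y$ iff $\iota(x)\le\iota(y)$. *)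

theory Defs
  imports Complex_Main
begin

definition natural_order :: "('a \<Rightarrow> 'a \<Rightarrow> bool) \<Rightarrow> bool" where
  "natural_order R \<longleftrightarrow>
     transp R \<and> (\<forall>x y. x \<noteq> y \<longrightarrow> (R x y \<or> R y x) \<and> \<not> (R x y \<and> R y x))"

definition embedding_for ::
  "('a::{plus,times} \<Rightarrow> 'a \<Rightarrow> bool) \<Rightarrow> ('b::{plus,times} \<Rightarrow> 'b \<Rightarrow> bool) \<Rightarrow> ('a \<Rightarrow> 'b) \<Rightarrow> bool" where
  "embedding_for le le' \<iota> \<longleftrightarrow>
     inj \<iota> \<and>
     (\<forall>x y. \<iota> (x + y) = \<iota> x + \<iota> y) \<and>
     (\<forall>x y. \<iota> (x * y) = \<iota> x * \<iota> y) \<and>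
     (\<forall>x y. le x y \<longleftrightarrow> le' (\<iota> x) (\<iota> y))"

text \<open>
  The type \<^typ>\<open>rat\<close> is the quotient of the integer fractions with nonzero denominator by
  cross-multiplication, with addition and multiplication lifted from the fraction formulas
  (\<open>eq_rat\<close>, \<open>add_rat\<close>, \<open>mult_rat\<close>). The library order on it is however defined
  through positivity of the difference, so the order is given here by its formula on fractions,
  in which denominators may have either sign. It is stated for some choice of representatives;
  \<open>rat_le_Fract\<close> shows that the choice is immaterial.
\<close>

definition rat_le :: "rat \<Rightarrow> rat \<Rightarrow> bool" where
  "rat_le x y \<longleftrightarrow>
     (\<exists>a b c d :: int. c \<noteq> 0 \<and> d \<noteq> 0 \<and> x = Fract a c \<and> y = Fract b d \<and>
        (c * d > 0 \<longrightarrow> a * d \<le> b * c) \<and>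
        (c * d < 0 \<longrightarrow> b * c \<le> a * d))"

lemma rat_le_Fract:
  assumes "c \<noteq> 0" "d \<noteq> 0"
  shows "rat_le (Fract a c) (Fract b d) \<longleftrightarrow>
           (if c * d > 0 then a * d \<le> b * c else b * c \<le> a * d)"
proof -
  have cross: "((c * d > 0 \<longrightarrow> a * d \<le> b * c) \<and> (c * d < 0 \<longrightarrow> b * c \<le> a * d)) \<longleftrightarrow>
      Fract a c \<le> Fract b d" if "c \<noteq> 0" "d \<noteq> 0" for a b c d :: int
  proof -
    have "c * d > 0 \<or> c * d < 0"
      using that by (metis linorder_neqE mult_eq_0_iff)
    then show ?thesis
      using that by (auto simp: le_rat mult_le_cancel_right simp del: zero_less_mult_iff mult_less_0_iff)
  qed
  have "rat_le (Fract a c) (Fract b d) \<longleftrightarrow> Fract a c \<le> Fract b d"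
    unfolding rat_le_def using assms cross by metis
  moreover have "c * d > 0 \<or> c * d < 0"
    using assms by (metis linorder_neqE mult_eq_0_iff)
  ultimately show ?thesis
    using cross[OF assms, of a b] by auto
qed

end

theory Submission
  imports Defs
begin

text \<open>
  The order given by the formula on fractions coincides with the order of the ordered field
  \<^typ>\<open>rat\<close> (\<open>rat_le_eq_less_eq\<close>). The first claim is then linearity of that
  order. The embedding is \<open>a \<mapsto> a/1\<close>, that is, \<^const>\<open>of_int\<close>, the unique
  ring homomorphism out of the integers; it is injective and reflects the order because an
  ordered field has characteristic zero.
\<close>

text \<open>
  The formula may be evaluated on any pair of representatives. On representatives with positive
  denominators only the branch \<open>a * d \<le> b * c\<close> occurs, and the library order reduces to
  the same inequality after cancelling the positive factor \<open>c * d\<close>.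
\<close>

lemma rat_le_eq_less_eq: "rat_le = (\<le>)"
proof (intro ext)
  fix x y :: rat
  obtain a c where x: "x = Fract a c" "c > 0"
    by (cases x) auto
  obtain b d where y: "y = Fract b d" "d > 0"
    by (cases y) auto
  have pos: "c * d > 0"
    using x(2) y(2) by simp
  have "rat_le x y \<longleftrightarrow> a * d \<le> b * c"
    using pos x y by (simp add: rat_le_Fract)
  also have "\<dots> \<longleftrightarrow> (a * d) * (c * d) \<le> (b * c) * (c * d)"
    using pos by (simp only: mult_le_cancel_right_pos)
  also have "\<dots> \<longleftrightarrow> x \<le> y"
    using x y by (simp add: le_rat)
  finally show "rat_le x y = (x \<le> y)" .
qed

lemma natural_order_less_eq: "natural_order ((\<le>) :: 'a::linorder \<Rightarrow> 'a \<Rightarrow> bool)"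
  unfolding natural_order_def by (auto intro: transpI)

lemma embedding_for_of_int:
  "embedding_for (\<le>) (\<le>) (of_int :: int \<Rightarrow> 'a::linordered_idom)"
  unfolding embedding_for_def by (simp add: inj_def)

theorem theorem7p9:
  shows "natural_order rat_le \<and> (\<exists>\<iota> :: int \<Rightarrow> rat. embedding_for (\<le>) rat_le \<iota>)"
  unfolding rat_le_eq_less_eq using natural_order_less_eq embedding_for_of_int by blast

end
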